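(* Let $V$ be a countable set. Let $(K_t)_{t\ge1}$ be a sequence of irreducible aperiodic Markov transition operators on $V$ and $(\pi_t)_{t\ge1}$ a sequence of finite measures such that $\{(K_t,\pi_t)\}_{t\ge1}$ is a finite non-decreasing environment; set $\pi_0=\pi_1$. For $t\ge s\ge0$ define the operator $O_{s,t}:\ell^2(\tilde\pi_t)\to\ell^2(\tilde\pi_s)$ by $$O_{s,t}f:=K_{s,t}f-\tilde\pi_s(K_{s,t}f),$$ and let $O_{s,t}^{\rightarrow}:\ell^2(\tilde\pi_s)\to\ell^2(\tilde\pi_t)$ be its dual, and $K_{s,t}^{\rightarrow}:\ell^2(\tilde\pi_s)\to\ell^2(\tilde\pi_t)$ the dual of $K_{s,t}:\ell^2(\tilde\pi_t)\to\ell^2(\tilde\pi_s)$. Let $\mathbf 1$ be the constant function equal to $1$, and for $z\in V$ and $t\ge0$ let $h_t^z=\mu_t^z/\tilde\pi_t$. Then: 1. For all $t\ge1$, the family $(O_{s,t})_{s\le t}$ forms a semigroup, i.e. $O_{s,r}O_{r,t}=O_{s,t}$ for all $0\le s\le r\le t$. 2. For all $t\ge s\ge0$ and all $f\in\ell^2(\tilde\pi_s)$, $\;O_{s,t}^{\rightarrow}f=K_{s,t}^{\rightarrow}f-\tilde\pi_s(f)\,K_{s,t}^{\rightarrow}\mathbf 1$. 3. For all $z\in V$ and $t\ge1$, $\;O_{0,t}^{\rightarrow}(h_0^z)=h_t^z-K_{0,t}^{\rightarrow}\mathbf 1$.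
   Context: A Markov transition operator $K$ on $V$ is a map $K:V\times V\to[0,1]$ with $\sum_y K(x,y)=1$ for all $x$; it acts on functions by $(Kf)(x)=\sum_y K(x,y)f(y)$ and on measures by $(\mu K)(y)=\sum_x\mu(x)K(x,y)$. For $0\le s<t$, $K_{s,t}=K_{s+1}\cdots K_t$, and $K_{t,t}=I$. Finite non-decreasing environment: the $\pi_t$ are positive measures ($\pi_t(x)>0$ for all $x$) with, for all $t\ge1$: $\pi_tK_t=\pi_t$; $\pi_t(V)<+\infty$; $\pi_{t+1}(x)\ge\pi_t(x)$ for all $x\in V$. For a finite measure $\pi$, $\tilde\pi:=\pi/\pi(V)$ and $\tilde\pi(f)=\sum_xf(x)\tilde\pi(x)$. $\mu_t^z=\delta_zK_1\cdots K_t$ is the law at time $t$ of the chain started at $z$ ($\mu_0^z=\delta_z$). The dual of an operator $A:\ell^2(\tilde\pi_t)\to\ell^2(\tilde\pi_s)$ is the operator $A^{\rightarrow}:\ell^2(\tilde\pi_s)\to\ell^2(\tilde\pi_t)$ with $\langle Af,g\rangle_{\tilde\pi_s}=\langle f,A^{\rightarrow}g\rangle_{\tilde\pi_t}$, where $\langle f,g\rangle_{\tilde\pi}=\sum_xf(x)g(x)\tilde\pi(x)$. *)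

theory Defs
  imports "HOL-Analysis.Analysis"
begin

type_synonym 'v kernel = "'v \<Rightarrow> 'v \<Rightarrow> real"

definition markov :: "'v kernel \<Rightarrow> bool" where
  "markov K \<longleftrightarrow> (\<forall>x y. 0 \<le> K x y \<and> K x y \<le> 1) \<and> (\<forall>x. (K x has_sum 1) UNIV)"

definition act_fun :: "'v kernel \<Rightarrow> ('v \<Rightarrow> real) \<Rightarrow> 'v \<Rightarrow> real" where
  "act_fun K f x = (\<Sum>\<^sub>\<infinity>y. K x y * f y)"

definition act_meas :: "('v \<Rightarrow> real) \<Rightarrow> 'v kernel \<Rightarrow> 'v \<Rightarrow> real" where
  "act_meas \<mu> K y = (\<Sum>\<^sub>\<infinity>x. \<mu> x * K x y)"

definition kernel_id :: "'v kernel" where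
  "kernel_id x y = (if x = y then 1 else 0)"

definition kernel_mult :: "'v kernel \<Rightarrow> 'v kernel \<Rightarrow> 'v kernel" where
  "kernel_mult K L x y = (\<Sum>\<^sub>\<infinity>z. K x z * L z y)"

definition kernel_power :: "'v kernel \<Rightarrow> nat \<Rightarrow> 'v kernel" where
  "kernel_power K n = (kernel_mult K ^^ n) kernel_id"

definition irreducible_kernel :: "'v kernel \<Rightarrow> bool" where
  "irreducible_kernel K \<longleftrightarrow> (\<forall>x y. \<exists>n. kernel_power K n x y > 0)"

definition aperiodic_kernel :: "'v kernel \<Rightarrow> bool" where
  "aperiodic_kernel K \<longleftrightarrow> (\<forall>x. Gcd {n. n \<ge> 1 \<and> kernel_power K n x x > 0} = 1)"

text \<open>\<open>K\<^sub>s\<^sub>,\<^sub>t = K\<^sub>s\<^sub>+\<^sub>1 \<dots> K\<^sub>t\<close>, meaningful for \<open>s \<le> t\<close>; the list is empty, and the product the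
  identity, when \<open>s = t\<close>. The kernel \<open>K 0\<close> never occurs.\<close>

definition kernel_between :: "(nat \<Rightarrow> 'v kernel) \<Rightarrow> nat \<Rightarrow> nat \<Rightarrow> 'v kernel" where
  "kernel_between K s t = foldr kernel_mult (map K [Suc s..<Suc t]) kernel_id"

text \<open>Measures on the countable type are represented by their point masses, and the total mass
  is finite iff the masses are summable.\<close>

definition finite_nondecreasing_env ::
    "(nat \<Rightarrow> 'v kernel) \<Rightarrow> (nat \<Rightarrow> 'v \<Rightarrow> real) \<Rightarrow> bool" where
  "finite_nondecreasing_env K \<pi> \<longleftrightarrow>
    (\<forall>t\<ge>1. (\<forall>x. \<pi> t x > 0) \<and> act_meas (\<pi> t) (K t) = \<pi> t
         \<and> \<pi> t summable_on UNIV \<and> (\<forall>x. \<pi> (Suc t) x \<ge> \<pi> t x))"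

definition normalized :: "('v \<Rightarrow> real) \<Rightarrow> 'v \<Rightarrow> real" where
  "normalized \<pi> x = \<pi> x / (\<Sum>\<^sub>\<infinity>y. \<pi> y)"

definition mean :: "('v \<Rightarrow> real) \<Rightarrow> ('v \<Rightarrow> real) \<Rightarrow> real" where
  "mean \<mu> f = (\<Sum>\<^sub>\<infinity>x. f x * \<mu> x)"

definition ell2 :: "('v \<Rightarrow> real) \<Rightarrow> ('v \<Rightarrow> real) set" where
  "ell2 \<mu> = {f. (\<lambda>x. (f x)\<^sup>2 * \<mu> x) summable_on UNIV}"

definition ell2_inner :: "('v \<Rightarrow> real) \<Rightarrow> ('v \<Rightarrow> real) \<Rightarrow> ('v \<Rightarrow> real) \<Rightarrow> real" where
  "ell2_inner \<mu> f g = (\<Sum>\<^sub>\<infinity>x. f x * g x * \<mu> x)"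

text \<open>\<open>B : \<ell>\<^sup>2(\<nu>) \<rightarrow> \<ell>\<^sup>2(\<mu>)\<close> is dual to \<open>A : \<ell>\<^sup>2(\<mu>) \<rightarrow> \<ell>\<^sup>2(\<nu>)\<close>. Operators are total functions in
  the logic, constrained only on the respective spaces.\<close>

definition is_dual :: "('v \<Rightarrow> real) \<Rightarrow> ('v \<Rightarrow> real) \<Rightarrow>
    (('v \<Rightarrow> real) \<Rightarrow> 'v \<Rightarrow> real) \<Rightarrow> (('v \<Rightarrow> real) \<Rightarrow> 'v \<Rightarrow> real) \<Rightarrow> bool" where
  "is_dual \<mu> \<nu> A B \<longleftrightarrow> A \<in> ell2 \<mu> \<rightarrow> ell2 \<nu> \<and> B \<in> ell2 \<nu> \<rightarrow> ell2 \<mu> \<and>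
    (\<forall>f\<in>ell2 \<mu>. \<forall>g\<in>ell2 \<nu>. ell2_inner \<nu> (A f) g = ell2_inner \<mu> f (B g))"

text \<open>When \<open>\<mu>\<close> has full support, point masses belong to \<open>\<ell>\<^sup>2(\<mu>)\<close> and determine \<open>h\<close> below, so
  \<open>dual \<mu> \<nu> A\<close> agrees on \<open>\<ell>\<^sup>2(\<nu>)\<close> with every operator dual to \<open>A\<close>.\<close>

definition dual :: "('v \<Rightarrow> real) \<Rightarrow> ('v \<Rightarrow> real) \<Rightarrow>
    (('v \<Rightarrow> real) \<Rightarrow> 'v \<Rightarrow> real) \<Rightarrow> ('v \<Rightarrow> real) \<Rightarrow> 'v \<Rightarrow> real" where
  "dual \<mu> \<nu> A g =
    (THE h. h \<in> ell2 \<mu> \<and> (\<forall>f\<in>ell2 \<mu>. ell2_inner \<nu> (A f) g = ell2_inner \<mu> f h))"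

definition K_op :: "(nat \<Rightarrow> 'v kernel) \<Rightarrow> nat \<Rightarrow> nat \<Rightarrow> ('v \<Rightarrow> real) \<Rightarrow> 'v \<Rightarrow> real" where
  "K_op K s t = act_fun (kernel_between K s t)"

definition O_op :: "(nat \<Rightarrow> 'v kernel) \<Rightarrow> (nat \<Rightarrow> 'v \<Rightarrow> real) \<Rightarrow> nat \<Rightarrow> nat \<Rightarrow>
    ('v \<Rightarrow> real) \<Rightarrow> 'v \<Rightarrow> real" where
  "O_op K \<pi> s t f = (\<lambda>x. K_op K s t f x - mean (normalized (\<pi> s)) (K_op K s t f))"

definition K_dual :: "(nat \<Rightarrow> 'v kernel) \<Rightarrow> (nat \<Rightarrow> 'v \<Rightarrow> real) \<Rightarrow> nat \<Rightarrow> nat \<Rightarrow>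
    ('v \<Rightarrow> real) \<Rightarrow> 'v \<Rightarrow> real" where
  "K_dual K \<pi> s t = dual (normalized (\<pi> t)) (normalized (\<pi> s)) (K_op K s t)"

definition O_dual :: "(nat \<Rightarrow> 'v kernel) \<Rightarrow> (nat \<Rightarrow> 'v \<Rightarrow> real) \<Rightarrow> nat \<Rightarrow> nat \<Rightarrow>
    ('v \<Rightarrow> real) \<Rightarrow> 'v \<Rightarrow> real" where
  "O_dual K \<pi> s t = dual (normalized (\<pi> t)) (normalized (\<pi> s)) (O_op K \<pi> s t)"

definition law :: "(nat \<Rightarrow> 'v kernel) \<Rightarrow> 'v \<Rightarrow> nat \<Rightarrow> 'v \<Rightarrow> real" where
  "law K z t = act_meas (kernel_id z) (kernel_between K 0 t)"

definition law_density :: "(nat \<Rightarrow> 'v kernel) \<Rightarrow> (nat \<Rightarrow> 'v \<Rightarrow> real) \<Rightarrow> 'v \<Rightarrow> nat \<Rightarrow>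
    'v \<Rightarrow> real" where
  "law_density K \<pi> z t x = law K z t x / normalized (\<pi> t) x"

end

theory Submission
  imports Defs
begin

text \<open>Monotonicity and invariance give \<open>\<pi>\<^sub>s K\<^sub>s\<^sub>,\<^sub>t \<le> \<pi>\<^sub>t\<close>. A Markov kernel \<open>P\<close> with \<open>\<nu> P \<le> C \<mu>\<close> maps
  \<open>\<ell>\<^sup>2(\<mu>)\<close> to \<open>\<ell>\<^sup>2(\<nu>)\<close> by Jensen's inequality, and by Cauchy--Schwarz and Fubini its dual is
  \<open>g \<mapsto> (g\<nu>)P / \<mu>\<close>. Centring subtracts \<open>\<langle>P f, 1\<rangle>\<^sub>\<nu> = \<langle>f, P\<^sup>\<rightarrow> 1\<rangle>\<^sub>\<mu>\<close>, which dualises to the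
  correction \<open>\<nu>(g) P\<^sup>\<rightarrow> 1\<close>; and \<open>h\<^sub>0\<^sup>z\<close> is a point mass divided by its weight, so that its
  mean is \<open>1\<close> and \<open>P\<^sup>\<rightarrow>\<close> sends it to the density of the law.\<close>

lemma summable_on_abs_iff:
  fixes f :: "'a \<Rightarrow> real"
  shows "(\<lambda>x. \<bar>f x\<bar>) summable_on A \<longleftrightarrow> f summable_on A"
  using summable_on_iff_abs_summable_on_real[of f A] by simp

lemma summable_on_real_bound:
  fixes f g :: "'a \<Rightarrow> real"
  assumes "g summable_on A" "\<And>x. x \<in> A \<Longrightarrow> \<bar>f x\<bar> \<le> g x"
  shows "f summable_on A"
  using Infinite_Sum.abs_summable_on_comparison_test'[OF assms(1), of f] assms(2)
  by (simp add: summable_on_abs_iff)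

lemma infsum_diff_real:
  fixes f g :: "'a \<Rightarrow> real"
  assumes "f summable_on A" "g summable_on A"
  shows "(\<Sum>\<^sub>\<infinity>x\<in>A. f x - g x) = infsum f A - infsum g A"
  using infsum_add[OF assms(1), of "\<lambda>x. - g x"] assms(2)
  by (simp add: infsum_uminus summable_on_uminus)

lemma abs_le_square_plus_1: "\<bar>a\<bar> \<le> a\<^sup>2 + (1::real)"
  using zero_le_power2[of "\<bar>a\<bar> - 1/2"] by (simp add: power2_eq_square algebra_simps)

lemma abs_mult_le_squares: "\<bar>a * b\<bar> \<le> a\<^sup>2 + (b\<^sup>2 :: real)"
proof -
  have "2 * (\<bar>a\<bar> * \<bar>b\<bar>) \<le> a\<^sup>2 + b\<^sup>2"
    using zero_le_power2[of "\<bar>a\<bar> - \<bar>b\<bar>"] by (simp add: power2_diff)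
  moreover have "0 \<le> a\<^sup>2 + b\<^sup>2" by simp
  ultimately show ?thesis unfolding abs_mult by linarith
qed

lemma weighted_summable:
  fixes w f :: "'a \<Rightarrow> real"
  assumes "\<And>x. 0 \<le> w x" "w summable_on UNIV" "(\<lambda>x. w x * (f x)\<^sup>2) summable_on UNIV"
  shows "(\<lambda>x. w x * f x) summable_on UNIV"
proof (rule summable_on_real_bound[OF summable_on_add[OF assms(3,2)]])
  fix x
  show "\<bar>w x * f x\<bar> \<le> w x * (f x)\<^sup>2 + w x"
    using mult_left_mono[OF abs_le_square_plus_1[of "f x"] assms(1)[of x]] assms(1)[of x]
    by (simp add: abs_mult algebra_simps)
qed

lemma weighted_cauchy_schwarz:
  fixes w f :: "'a \<Rightarrow> real"
  assumes w: "\<And>x. 0 \<le> w x" "w summable_on UNIV"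
    and f: "(\<lambda>x. w x * (f x)\<^sup>2) summable_on UNIV"
  shows "(\<Sum>\<^sub>\<infinity>x. w x * f x)\<^sup>2 \<le> (\<Sum>\<^sub>\<infinity>x. w x) * (\<Sum>\<^sub>\<infinity>x. w x * (f x)\<^sup>2)"
proof -
  define W M Q where "W = (\<Sum>\<^sub>\<infinity>x. w x)" and "M = (\<Sum>\<^sub>\<infinity>x. w x * f x)"
    and "Q = (\<Sum>\<^sub>\<infinity>x. w x * (f x)\<^sup>2)"
  have W: "(w has_sum W) UNIV" and Q: "((\<lambda>x. w x * (f x)\<^sup>2) has_sum Q) UNIV"
    unfolding W_def Q_def using w f by (auto intro: has_sum_infsum)
  have M: "((\<lambda>x. w x * f x) has_sum M) UNIV"
    unfolding M_def by (rule has_sum_infsum[OF weighted_summable[OF assms]])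
  have "((\<lambda>x. W\<^sup>2 * (w x * (f x)\<^sup>2) + (- 2 * W * M) * (w x * f x) + M\<^sup>2 * w x) has_sum
          (W\<^sup>2 * Q + (- 2 * W * M) * M + M\<^sup>2 * W)) UNIV"
    by (intro has_sum_add has_sum_cmult_right W Q M)
  moreover have "W\<^sup>2 * (w x * (f x)\<^sup>2) + (- 2 * W * M) * (w x * f x) + M\<^sup>2 * w x
      = w x * (W * f x - M)\<^sup>2" for x
    by (simp add: power2_eq_square algebra_simps)
  ultimately have "0 \<le> W\<^sup>2 * Q + (- 2 * W * M) * M + M\<^sup>2 * W"
    using w(1) by (auto intro: has_sum_nonneg)
  then have ge: "0 \<le> W * (W * Q - M\<^sup>2)"
    by (simp add: power2_eq_square algebra_simps)
  have "0 \<le> W" using W w(1) by (auto intro: has_sum_nonneg)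
  show ?thesis
  proof (cases "W = 0")
    case True
    then have "w x = 0" for x
      using nonneg_infsum_le_0D[of w UNIV x] w by (simp add: W_def)
    then show ?thesis by simp
  next
    case False
    with ge \<open>0 \<le> W\<close> show ?thesis
      unfolding W_def[symmetric] M_def[symmetric] Q_def[symmetric]
      by (simp add: zero_le_mult_iff)
  qed
qed

lemma infsum_kronecker_left: "(\<Sum>\<^sub>\<infinity>y. kernel_id x y * f y) = f x"
  by (rule infsumI, rule has_sum_finite_neutralI[of "{x}"]) (auto simp: kernel_id_def)

lemma infsum_kronecker_right: "(\<Sum>\<^sub>\<infinity>x. f x * kernel_id x y) = f y"
  by (rule infsumI, rule has_sum_finite_neutralI[of "{y}"]) (auto simp: kernel_id_def)

lemma act_fun_kernel_id: "act_fun kernel_id f = f"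
  by (simp add: fun_eq_iff act_fun_def infsum_kronecker_left)

lemma act_meas_kernel_id: "act_meas \<mu> kernel_id = \<mu>"
  by (simp add: fun_eq_iff act_meas_def infsum_kronecker_right)

lemma markovI:
  assumes nonneg: "\<And>x y. 0 \<le> K x y" and sum: "\<And>x. (K x has_sum 1) UNIV"
  shows "markov K"
proof -
  have "K x y \<le> 1" for x y
    using finite_sum_le_has_sum[OF sum[of x], of "{y}"] nonneg by simp
  then show ?thesis using assms by (simp add: markov_def)
qed

lemma markov_kernel_id: "markov kernel_id"
proof (rule markovI)
  show "(kernel_id x has_sum 1) UNIV" for x :: 'a
    by (rule has_sum_finite_neutralI[of "{x}"]) (auto simp: kernel_id_def)
qed (simp add: kernel_id_def)

lemma markov_kernel_mult:
  assumes P: "markov P" and Q: "markov Q"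
  shows "markov (kernel_mult P Q)"
proof (rule markovI)
  fix x
  have nonneg: "0 \<le> P x z" "0 \<le> Q z y" for z y using P Q by (auto simp: markov_def)
  have Psum: "(P x has_sum 1) UNIV" and Qsum: "(Q z has_sum 1) UNIV" for z
    using P Q by (auto simp: markov_def)
  have inner: "((\<lambda>y. P x z * Q z y) has_sum P x z) UNIV" for z
    using has_sum_cmult_right[OF Qsum, of "P x z"] by simp
  have joint: "(\<lambda>(z, y). P x z * Q z y) summable_on UNIV \<times> UNIV"
    by (rule summable_on_SigmaI[where g = "P x"])
      (use inner Psum nonneg in \<open>auto simp: summable_on_def\<close>)
  have "(\<Sum>\<^sub>\<infinity>y. kernel_mult P Q x y) = 1"
    unfolding kernel_mult_def infsum_swap_banach[OF joint, symmetric]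
    using infsumI[OF inner] infsumI[OF Psum] by simp
  moreover have "(\<lambda>y. kernel_mult P Q x y) summable_on UNIV"
    unfolding kernel_mult_def
    by (rule summable_on_Sigma_banach)
      (use joint in \<open>subst summable_on_swap, simp add: case_prod_beta\<close>)
  ultimately show "(kernel_mult P Q x has_sum 1) UNIV"
    by (metis has_sum_infsum)
  show "0 \<le> kernel_mult P Q x y" for y
    unfolding kernel_mult_def by (intro infsum_nonneg mult_nonneg_nonneg nonneg)
qed

lemma ell2_integrable:
  assumes "\<And>x. 0 \<le> \<mu> x" "\<mu> summable_on UNIV" "f \<in> ell2 \<mu>"
  shows "(\<lambda>x. f x * \<mu> x) summable_on UNIV"
  using weighted_summable[of \<mu> f] assms by (simp add: ell2_def mult.commute)

lemma ell2_mult_integrable: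
  assumes "\<And>x. 0 \<le> \<mu> x" "f \<in> ell2 \<mu>" "g \<in> ell2 \<mu>"
  shows "(\<lambda>x. f x * g x * \<mu> x) summable_on UNIV"
proof (rule summable_on_real_bound)
  show "(\<lambda>x. (f x)\<^sup>2 * \<mu> x + (g x)\<^sup>2 * \<mu> x) summable_on UNIV"
    using assms by (intro summable_on_add) (auto simp: ell2_def)
  show "\<bar>f x * g x * \<mu> x\<bar> \<le> (f x)\<^sup>2 * \<mu> x + (g x)\<^sup>2 * \<mu> x" for x
    using mult_right_mono[OF abs_mult_le_squares[of "f x" "g x"] assms(1)[of x]] assms(1)[of x]
    by (simp add: abs_mult algebra_simps)
qed

lemma ell2_const:
  assumes "\<mu> summable_on UNIV"
  shows "(\<lambda>_. c) \<in> ell2 \<mu>"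
  using summable_on_cmult_right[OF assms] by (simp add: ell2_def)

lemma ell2_cmult:
  assumes "f \<in> ell2 \<mu>"
  shows "(\<lambda>x. c * f x) \<in> ell2 \<mu>"
  using assms summable_on_cmult_right[of "\<lambda>x. (f x)\<^sup>2 * \<mu> x" UNIV "c\<^sup>2"]
  by (simp add: ell2_def power_mult_distrib mult.assoc)

lemma ell2_diff:
  assumes \<mu>: "\<And>x. 0 \<le> \<mu> x" and f: "f \<in> ell2 \<mu>" and g: "g \<in> ell2 \<mu>"
  shows "(\<lambda>x. f x - g x) \<in> ell2 \<mu>"
proof -
  have "(\<lambda>x. (f x)\<^sup>2 * \<mu> x + (-2) * (f x * g x * \<mu> x) + (g x)\<^sup>2 * \<mu> x) summable_on UNIV"
    using f g by (intro summable_on_add summable_on_cmult_right ell2_mult_integrable \<mu>)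
      (auto simp: ell2_def)
  then show ?thesis
    by (simp add: ell2_def power2_diff algebra_simps)
qed

lemma ell2_kernel_id:
  fixes \<mu> :: "'a \<Rightarrow> real"
  shows "kernel_id z \<in> ell2 \<mu>"
  unfolding ell2_def mem_Collect_eq
  by (rule finite_nonzero_values_imp_summable_on, rule finite_subset[of _ "{z}"])
    (auto simp: kernel_id_def)

lemma ell2_inner_diff_left:
  assumes "\<And>x. 0 \<le> \<mu> x" "f \<in> ell2 \<mu>" "g \<in> ell2 \<mu>" "h \<in> ell2 \<mu>"
  shows "ell2_inner \<mu> (\<lambda>x. f x - g x) h = ell2_inner \<mu> f h - ell2_inner \<mu> g h"
  using infsum_diff_real[OF ell2_mult_integrable[OF assms(1,2,4)] ell2_mult_integrable[OF assms(1,3,4)]]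
  by (simp add: ell2_inner_def algebra_simps)

lemma ell2_inner_commute: "ell2_inner \<mu> f g = ell2_inner \<mu> g f"
  by (simp add: ell2_inner_def mult.commute)

lemma ell2_inner_cmult_right: "ell2_inner \<mu> f (\<lambda>x. c * g x) = c * ell2_inner \<mu> f g"
  unfolding ell2_inner_def infsum_cmult_right'[symmetric] by (simp add: mult_ac)

lemma ell2_inner_kernel_id: "ell2_inner \<mu> (kernel_id z) h = h z * \<mu> z"
  by (simp add: ell2_inner_def mult.assoc infsum_kronecker_left)

lemma mean_eq_ell2_inner: "mean \<mu> f = ell2_inner \<mu> f (\<lambda>_. 1)"
  by (simp add: mean_def ell2_inner_def)

lemma dual_eq:
  assumes dual: "is_dual \<mu> \<nu> A B" and pos: "\<And>x. 0 < \<mu> x" and g: "g \<in> ell2 \<nu>"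
  shows "dual \<mu> \<nu> A g = B g"
  unfolding dual_def
proof (rule the_equality)
  show B: "B g \<in> ell2 \<mu> \<and> (\<forall>f\<in>ell2 \<mu>. ell2_inner \<nu> (A f) g = ell2_inner \<mu> f (B g))"
    using dual g by (auto simp: is_dual_def)
  fix h assume h: "h \<in> ell2 \<mu> \<and> (\<forall>f\<in>ell2 \<mu>. ell2_inner \<nu> (A f) g = ell2_inner \<mu> f h)"
  show "h = B g"
  proof
    fix z
    have "ell2_inner \<mu> (kernel_id z) h = ell2_inner \<mu> (kernel_id z) (B g)"
      using h B ell2_kernel_id[of z \<mu>] by metis
    then show "h z = B g z"
      using pos[of z] by (simp add: ell2_inner_kernel_id)
  qed
qed

lemma is_dual_dual:
  assumes dual: "is_dual \<mu> \<nu> A B" and pos: "\<And>x. 0 < \<mu> x"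
  shows "is_dual \<mu> \<nu> A (dual \<mu> \<nu> A)"
  using dual by (auto simp: is_dual_def Pi_iff dual_eq[OF assms])

locale dominated_kernel =
  fixes P :: "'v kernel" and \<nu> \<mu> :: "'v \<Rightarrow> real" and C :: real
  assumes markov: "markov P"
    and \<nu>_pos: "\<And>x. 0 < \<nu> x" and \<nu>_summable: "\<nu> summable_on UNIV"
    and \<mu>_pos: "\<And>x. 0 < \<mu> x" and \<mu>_summable: "\<mu> summable_on UNIV"
    and dominated: "\<And>y. act_meas \<nu> P y \<le> C * \<mu> y"
begin

lemma \<nu>_nonneg: "0 \<le> \<nu> x" and \<mu>_nonneg: "0 \<le> \<mu> x"
  using \<nu>_pos \<mu>_pos by (auto intro: less_imp_le)

lemma P_nonneg: "0 \<le> P x y" and P_le_1: "P x y \<le> 1" and P_has_sum: "(P x has_sum 1) UNIV"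
  using markov by (auto simp: markov_def)

lemma P_summable: "P x summable_on UNIV"
  using P_has_sum summable_on_def by blast

lemma act_meas_has_sum: "((\<lambda>x. \<nu> x * P x y) has_sum act_meas \<nu> P y) UNIV"
  unfolding act_meas_def
proof (intro has_sum_infsum summable_on_real_bound[OF \<nu>_summable])
  show "\<bar>\<nu> x * P x y\<bar> \<le> \<nu> x" for x
    using mult_left_mono[OF P_le_1 \<nu>_nonneg] \<nu>_nonneg P_nonneg by (simp add: abs_mult)
qed

lemma act_meas_nonneg: "0 \<le> act_meas \<nu> P y"
  by (rule has_sum_nonneg[OF act_meas_has_sum]) (simp add: \<nu>_nonneg P_nonneg)

lemma joint_summable:
  assumes f: "(\<lambda>y. f y * \<mu> y) summable_on UNIV"
  shows "(\<lambda>(x, y). \<nu> x * P x y * f y) summable_on UNIV \<times> UNIV"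
proof (rule summable_on_real_bound)
  have "(\<lambda>(y, x). \<nu> x * P x y * \<bar>f y\<bar>) summable_on UNIV \<times> UNIV"
  proof (rule summable_on_SigmaI[where g = "\<lambda>y. act_meas \<nu> P y * \<bar>f y\<bar>"])
    have "(\<lambda>y. C * \<bar>f y * \<mu> y\<bar>) summable_on UNIV"
      using f by (intro summable_on_cmult_right) (simp add: summable_on_abs_iff)
    then show "(\<lambda>y. act_meas \<nu> P y * \<bar>f y\<bar>) summable_on UNIV"
    proof (rule summable_on_real_bound)
      show "\<bar>act_meas \<nu> P y * \<bar>f y\<bar>\<bar> \<le> C * \<bar>f y * \<mu> y\<bar>" for y
        using mult_right_mono[OF dominated[of y], of "\<bar>f y\<bar>"] act_meas_nonneg[of y] \<mu>_nonneg[of y]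
        by (simp add: abs_mult mult_ac)
    qed
  qed (use \<nu>_nonneg P_nonneg in \<open>auto intro!: has_sum_cmult_left act_meas_has_sum\<close>)
  then show "(\<lambda>(x, y). \<nu> x * P x y * \<bar>f y\<bar>) summable_on UNIV \<times> UNIV"
    by (subst summable_on_swap) (simp add: case_prod_beta)
qed (use \<nu>_nonneg P_nonneg in \<open>auto simp: abs_mult\<close>)

lemma row_summable:
  assumes "(\<lambda>y. f y * \<mu> y) summable_on UNIV"
  shows "(\<lambda>y. P x y * f y) summable_on UNIV"
  using summable_on_SigmaD1[OF joint_summable[OF assms], of x] \<nu>_pos[of x]
  by (simp add: mult.assoc summable_on_cmult_right')

lemma act_fun_integrable:
  assumes "(\<lambda>y. f y * \<mu> y) summable_on UNIV"
  shows "(\<lambda>x. act_fun P f x * \<nu> x) summable_on UNIV"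
  using summable_on_Sigma_banach[OF joint_summable[OF assms]]
  by (simp add: act_fun_def mult.assoc infsum_cmult_right' mult.commute[of _ "\<nu> _"])

lemma infsum_act_fun:
  assumes "(\<lambda>y. f y * \<mu> y) summable_on UNIV"
  shows "(\<Sum>\<^sub>\<infinity>x. \<nu> x * act_fun P f x) = (\<Sum>\<^sub>\<infinity>y. act_meas \<nu> P y * f y)"
proof -
  have "(\<Sum>\<^sub>\<infinity>x. \<nu> x * act_fun P f x) = (\<Sum>\<^sub>\<infinity>x. \<Sum>\<^sub>\<infinity>y. \<nu> x * P x y * f y)"
    by (simp only: act_fun_def infsum_cmult_right' mult.assoc)
  also have "\<dots> = (\<Sum>\<^sub>\<infinity>y. \<Sum>\<^sub>\<infinity>x. \<nu> x * P x y * f y)"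
    by (rule infsum_swap_banach[OF joint_summable[OF assms]])
  also have "\<dots> = (\<Sum>\<^sub>\<infinity>y. act_meas \<nu> P y * f y)"
    by (simp only: act_meas_def infsum_cmult_left')
  finally show ?thesis .
qed

lemma act_fun_const: "act_fun P (\<lambda>_. c) = (\<lambda>_. c)"
  using infsumI[OF P_has_sum] by (simp add: fun_eq_iff act_fun_def infsum_cmult_left')

lemma act_fun_diff:
  assumes "(\<lambda>y. f y * \<mu> y) summable_on UNIV" "(\<lambda>y. g y * \<mu> y) summable_on UNIV"
  shows "act_fun P (\<lambda>y. f y - g y) x = act_fun P f x - act_fun P g x"
  using infsum_diff_real[OF row_summable[OF assms(1), of x] row_summable[OF assms(2), of x]]
  by (simp add: act_fun_def algebra_simps)

lemma act_fun_ell2: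
  assumes f: "f \<in> ell2 \<mu>"
  shows "act_fun P f \<in> ell2 \<nu>"
proof -
  have sq: "(\<lambda>y. (f y)\<^sup>2 * \<mu> y) summable_on UNIV" using f by (simp add: ell2_def)
  have "(act_fun P f x)\<^sup>2 \<le> act_fun P (\<lambda>y. (f y)\<^sup>2) x" for x
    using weighted_cauchy_schwarz[OF P_nonneg P_summable row_summable[OF sq], of x]
      infsumI[OF P_has_sum[of x]]
    by (simp add: act_fun_def)
  then show ?thesis
    unfolding ell2_def mem_Collect_eq
    by (intro summable_on_real_bound[OF act_fun_integrable[OF sq]])
      (simp add: abs_mult \<nu>_nonneg mult_right_mono)
qed

definition adjoint :: "('v \<Rightarrow> real) \<Rightarrow> 'v \<Rightarrow> real" where
  "adjoint g y = act_meas (\<lambda>x. g x * \<nu> x) P y / \<mu> y"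

lemma joint_summable_left:
  assumes "(\<lambda>x. g x * \<nu> x) summable_on UNIV"
  shows "(\<lambda>(x, y). \<nu> x * P x y * g x) summable_on UNIV \<times> UNIV"
proof (rule summable_on_real_bound)
  show "(\<lambda>(x, y). \<bar>g x * \<nu> x\<bar> * P x y) summable_on UNIV \<times> UNIV"
  proof (rule summable_on_SigmaI[where g = "\<lambda>x. \<bar>g x * \<nu> x\<bar>"])
    show "((\<lambda>y. case (x, y) of (x, y) \<Rightarrow> \<bar>g x * \<nu> x\<bar> * P x y) has_sum \<bar>g x * \<nu> x\<bar>) UNIV" for x
      using has_sum_cmult_right[OF P_has_sum[of x], of "\<bar>g x * \<nu> x\<bar>"] by simp
    show "(\<lambda>x. \<bar>g x * \<nu> x\<bar>) summable_on UNIV"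
      using assms by (simp add: summable_on_abs_iff)
  qed (use P_nonneg in auto)
qed (use P_nonneg \<nu>_nonneg in \<open>auto simp: abs_mult mult_ac\<close>)

lemma joint_summable_ell2:
  assumes f: "f \<in> ell2 \<mu>" and g: "g \<in> ell2 \<nu>"
  shows "(\<lambda>(x, y). \<nu> x * P x y * g x * f y) summable_on UNIV \<times> UNIV"
proof (rule summable_on_real_bound)
  show "(\<lambda>p. (case p of (x, y) \<Rightarrow> \<nu> x * P x y * (g x)\<^sup>2)
      + (case p of (x, y) \<Rightarrow> \<nu> x * P x y * (f y)\<^sup>2)) summable_on UNIV \<times> UNIV"
    using f g by (intro summable_on_add joint_summable joint_summable_left) (auto simp: ell2_def)
  show "\<bar>case p of (x, y) \<Rightarrow> \<nu> x * P x y * g x * f y\<bar>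
      \<le> (case p of (x, y) \<Rightarrow> \<nu> x * P x y * (g x)\<^sup>2)
        + (case p of (x, y) \<Rightarrow> \<nu> x * P x y * (f y)\<^sup>2)" for p
  proof (cases p)
    case (Pair x y)
    show ?thesis
      using mult_left_mono[OF abs_mult_le_squares[of "g x" "f y"], of "\<nu> x * P x y"]
        \<nu>_nonneg[of x] P_nonneg[of x y]
      by (simp add: Pair abs_mult algebra_simps)
  qed
qed

lemma adjoint_ell2:
  assumes g: "g \<in> ell2 \<nu>"
  shows "adjoint g \<in> ell2 \<mu>"
proof -
  have sq: "(\<lambda>(x, y). \<nu> x * P x y * (g x)\<^sup>2) summable_on UNIV \<times> UNIV"
    using g by (intro joint_summable_left) (simp add: ell2_def)
  then have sq': "(\<lambda>(y, x). \<nu> x * P x y * (g x)\<^sup>2) summable_on UNIV \<times> UNIV"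
    by (subst summable_on_swap) (simp add: case_prod_beta)
  define S where "S y = (\<Sum>\<^sub>\<infinity>x. \<nu> x * P x y * (g x)\<^sup>2)" for y
  have S: "S summable_on UNIV"
    using summable_on_Sigma_banach[OF sq'] by (simp add: S_def[abs_def])
  have S_nonneg: "0 \<le> S y" for y
    unfolding S_def by (intro infsum_nonneg mult_nonneg_nonneg \<nu>_nonneg P_nonneg) auto
  have "(adjoint g y)\<^sup>2 * \<mu> y \<le> C * S y" for y
  proof -
    have "(act_meas (\<lambda>x. g x * \<nu> x) P y)\<^sup>2 \<le> act_meas \<nu> P y * S y"
      using weighted_cauchy_schwarz[of "\<lambda>x. \<nu> x * P x y" g]
        summable_on_SigmaD1[OF sq', of y] act_meas_has_sum[of y] \<nu>_nonneg P_nonneg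
      by (auto simp: act_meas_def S_def summable_on_def mult_ac)
    also have "\<dots> \<le> C * \<mu> y * S y"
      by (intro mult_right_mono dominated S_nonneg)
    finally show ?thesis
      using \<mu>_pos[of y] by (simp add: adjoint_def power_divide power2_eq_square field_simps)
  qed
  then show ?thesis
    unfolding ell2_def mem_Collect_eq
    by (intro summable_on_real_bound[OF summable_on_cmult_right[OF S, of C]])
      (simp add: abs_mult \<mu>_nonneg)
qed

lemma act_fun_adjoint:
  assumes "f \<in> ell2 \<mu>" "g \<in> ell2 \<nu>"
  shows "ell2_inner \<nu> (act_fun P f) g = ell2_inner \<mu> f (adjoint g)"
proof -
  have "ell2_inner \<nu> (act_fun P f) g = (\<Sum>\<^sub>\<infinity>x. \<Sum>\<^sub>\<infinity>y. \<nu> x * P x y * g x * f y)"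
    unfolding ell2_inner_def act_fun_def infsum_cmult_left'[symmetric]
    by (simp add: mult_ac)
  also have "\<dots> = (\<Sum>\<^sub>\<infinity>y. \<Sum>\<^sub>\<infinity>x. \<nu> x * P x y * g x * f y)"
    by (rule infsum_swap_banach[OF joint_summable_ell2[OF assms]])
  also have "\<dots> = (\<Sum>\<^sub>\<infinity>y. f y * act_meas (\<lambda>x. g x * \<nu> x) P y)"
    unfolding act_meas_def infsum_cmult_right'[symmetric] by (simp add: mult_ac)
  also have "\<dots> = ell2_inner \<mu> f (adjoint g)"
    using \<mu>_pos by (simp add: ell2_inner_def adjoint_def less_imp_neq[THEN not_sym])
  finally show ?thesis .
qed

lemma is_dual_adjoint: "is_dual \<mu> \<nu> (act_fun P) adjoint"
  by (simp add: is_dual_def act_fun_ell2 adjoint_ell2 act_fun_adjoint)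

lemma is_dual_centred:
  "is_dual \<mu> \<nu> (\<lambda>f x. act_fun P f x - mean \<nu> (act_fun P f))
    (\<lambda>g y. adjoint g y - mean \<nu> g * adjoint (\<lambda>_. 1) y)"
  unfolding is_dual_def
proof (intro conjI ballI Pi_I)
  have one: "(\<lambda>_. 1) \<in> ell2 \<nu>" by (rule ell2_const[OF \<nu>_summable])
  show "(\<lambda>x. act_fun P f x - mean \<nu> (act_fun P f)) \<in> ell2 \<nu>" if "f \<in> ell2 \<mu>" for f
    using that by (intro ell2_diff ell2_const act_fun_ell2 \<nu>_nonneg \<nu>_summable)
  show "(\<lambda>y. adjoint g y - mean \<nu> g * adjoint (\<lambda>_. 1) y) \<in> ell2 \<mu>" if "g \<in> ell2 \<nu>" for g
    using that one by (intro ell2_diff ell2_cmult adjoint_ell2 \<mu>_nonneg)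
  fix f g assume f: "f \<in> ell2 \<mu>" and g: "g \<in> ell2 \<nu>"
  define c where "c = mean \<nu> (act_fun P f)"
  have c: "c = ell2_inner \<mu> f (adjoint (\<lambda>_. 1))"
    using f one by (simp add: c_def mean_eq_ell2_inner act_fun_adjoint)
  have "ell2_inner \<nu> (\<lambda>_. c) g = c * mean \<nu> g"
    by (simp add: ell2_inner_def mean_def infsum_cmult_right'[symmetric] mult.assoc)
  then have "ell2_inner \<nu> (\<lambda>x. act_fun P f x - c) g
      = ell2_inner \<mu> f (adjoint g) - ell2_inner \<mu> f (\<lambda>y. mean \<nu> g * adjoint (\<lambda>_. 1) y)"
    using f g c
    by (simp add: ell2_inner_diff_left \<nu>_nonneg ell2_const \<nu>_summable act_fun_ell2 act_fun_adjoint
        ell2_inner_cmult_right)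
  also have "\<dots> = ell2_inner \<mu> f (\<lambda>y. adjoint g y - mean \<nu> g * adjoint (\<lambda>_. 1) y)"
    using f g one
    by (subst (1 2 3) ell2_inner_commute)
      (simp add: ell2_inner_diff_left \<mu>_nonneg adjoint_ell2 ell2_cmult)
  finally show "ell2_inner \<nu> (\<lambda>x. act_fun P f x - mean \<nu> (act_fun P f)) g
      = ell2_inner \<mu> f (\<lambda>y. adjoint g y - mean \<nu> g * adjoint (\<lambda>_. 1) y)"
    by (simp add: c_def)
qed

end

lemma act_fun_kernel_mult:
  assumes P: "dominated_kernel P \<nu> \<rho> C" and Q: "dominated_kernel Q \<rho> \<mu> D"
    and f: "(\<lambda>y. f y * \<mu> y) summable_on UNIV"
  shows "act_fun (kernel_mult P Q) f = act_fun P (act_fun Q f)"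
proof
  fix x
  interpret P: dominated_kernel P \<nu> \<rho> C by fact
  interpret Q: dominated_kernel Q \<rho> \<mu> D by fact
  have f': "(\<lambda>y. \<bar>f y\<bar> * \<mu> y) summable_on UNIV"
    using f summable_on_abs_iff[of "\<lambda>y. f y * \<mu> y" UNIV] by (simp add: abs_mult Q.\<mu>_nonneg)
  have joint: "(\<lambda>(z, y). P x z * Q z y * f y) summable_on UNIV \<times> UNIV"
  proof (rule summable_on_real_bound)
    show "(\<lambda>(z, y). P x z * (Q z y * \<bar>f y\<bar>)) summable_on UNIV \<times> UNIV"
    proof (rule summable_on_SigmaI)
      show "((\<lambda>y. case (z, y) of (z, y) \<Rightarrow> P x z * (Q z y * \<bar>f y\<bar>)) has_sum
          P x z * act_fun Q (\<lambda>y. \<bar>f y\<bar>) z) UNIV" for z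
        unfolding act_fun_def prod.case
        by (intro has_sum_cmult_right has_sum_infsum Q.row_summable f')
      show "(\<lambda>z. P x z * act_fun Q (\<lambda>y. \<bar>f y\<bar>) z) summable_on UNIV"
        by (intro P.row_summable Q.act_fun_integrable f')
    qed (use P.P_nonneg Q.P_nonneg in auto)
  qed (use P.P_nonneg Q.P_nonneg in \<open>auto simp: abs_mult\<close>)
  have "act_fun (kernel_mult P Q) f x = (\<Sum>\<^sub>\<infinity>y. \<Sum>\<^sub>\<infinity>z. P x z * Q z y * f y)"
    by (simp add: act_fun_def kernel_mult_def infsum_cmult_left')
  also have "\<dots> = (\<Sum>\<^sub>\<infinity>z. \<Sum>\<^sub>\<infinity>y. P x z * Q z y * f y)"
    by (rule infsum_swap_banach[OF joint, symmetric])
  also have "\<dots> = act_fun P (act_fun Q f) x"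
    by (simp add: act_fun_def mult.assoc infsum_cmult_right')
  finally show "act_fun (kernel_mult P Q) f x = act_fun P (act_fun Q f) x" .
qed

lemma dominated_kernel_mult:
  assumes P: "dominated_kernel P \<nu> \<rho> C" and Q: "dominated_kernel Q \<rho> \<mu> D" and C: "0 \<le> C"
  shows "dominated_kernel (kernel_mult P Q) \<nu> \<mu> (C * D)"
proof
  interpret P: dominated_kernel P \<nu> \<rho> C by fact
  interpret Q: dominated_kernel Q \<rho> \<mu> D by fact
  show "markov (kernel_mult P Q)"
    by (rule markov_kernel_mult[OF P.markov Q.markov])
  fix y
  have Qy: "(\<lambda>z. Q z y * \<rho> z) summable_on UNIV"
    using Q.act_meas_has_sum[of y] by (auto simp: summable_on_def mult.commute)
  have "act_meas \<nu> (kernel_mult P Q) y = (\<Sum>\<^sub>\<infinity>x. \<nu> x * act_fun P (\<lambda>z. Q z y) x)"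
    by (simp add: act_meas_def kernel_mult_def act_fun_def)
  also have "\<dots> = (\<Sum>\<^sub>\<infinity>z. act_meas \<nu> P z * Q z y)"
    by (rule P.infsum_act_fun[OF Qy])
  also have "\<dots> \<le> (\<Sum>\<^sub>\<infinity>z. C * (Q z y * \<rho> z))"
  proof (rule infsum_mono)
    show le: "act_meas \<nu> P z * Q z y \<le> C * (Q z y * \<rho> z)" for z
      using mult_right_mono[OF P.dominated Q.P_nonneg] by (simp add: mult_ac)
    show sum: "(\<lambda>z. C * (Q z y * \<rho> z)) summable_on UNIV"
      by (rule summable_on_cmult_right[OF Qy])
    show "(\<lambda>z. act_meas \<nu> P z * Q z y) summable_on UNIV"
      by (rule summable_on_real_bound[OF sum])
        (use le P.act_meas_nonneg Q.P_nonneg in \<open>auto simp: abs_mult\<close>)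
  qed
  also have "\<dots> = C * act_meas \<rho> Q y"
    by (simp add: infsum_cmult_right' act_meas_def mult.commute)
  also have "\<dots> \<le> C * D * \<mu> y"
    using mult_left_mono[OF Q.dominated C] by (simp add: mult.assoc)
  finally show "act_meas \<nu> (kernel_mult P Q) y \<le> C * D * \<mu> y" .
qed (use P Q in \<open>auto simp: dominated_kernel_def\<close>)

lemma kernel_between_refl: "kernel_between K s s = kernel_id"
  by (simp add: kernel_between_def)

lemma kernel_between_step:
  "s < t \<Longrightarrow> kernel_between K s t = kernel_mult (K (Suc s)) (kernel_between K (Suc s) t)"
  by (simp add: kernel_between_def upt_conv_Cons del: upt_Suc)

lemma infsum_positive:
  fixes \<pi> :: "'a \<Rightarrow> real"
  assumes "\<And>x. 0 < \<pi> x" "\<pi> summable_on UNIV"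
  shows "0 < (\<Sum>\<^sub>\<infinity>x. \<pi> x)"
proof -
  have "\<pi> undefined \<le> (\<Sum>\<^sub>\<infinity>x. \<pi> x)"
    using finite_sum_le_infsum[OF assms(2), of "{undefined}"] assms(1) by (simp add: less_imp_le)
  then show ?thesis using assms(1)[of undefined] by linarith
qed

lemma normalized_has_sum:
  fixes \<pi> :: "'a \<Rightarrow> real"
  assumes "\<And>x. 0 < \<pi> x" "\<pi> summable_on UNIV"
  shows "(normalized \<pi> has_sum 1) UNIV"
  using has_sum_cmult_left[OF has_sum_infsum[OF assms(2)], of "1 / (\<Sum>\<^sub>\<infinity>x. \<pi> x)"]
    infsum_positive[OF assms]
  by (simp add: normalized_def[abs_def])

lemma dominated_kernel_normalized:
  assumes "dominated_kernel P \<nu> \<mu> C"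
  shows "dominated_kernel P (normalized \<nu>) (normalized \<mu>)
    (C * (\<Sum>\<^sub>\<infinity>x. \<mu> x) / (\<Sum>\<^sub>\<infinity>x. \<nu> x))"
proof
  interpret dominated_kernel P \<nu> \<mu> C by fact
  note pos = infsum_positive[OF \<nu>_pos \<nu>_summable] infsum_positive[OF \<mu>_pos \<mu>_summable]
  show "markov P" by (rule markov)
  show "0 < normalized \<nu> x" "0 < normalized \<mu> x" for x
    using pos \<nu>_pos \<mu>_pos by (auto simp: normalized_def)
  show "normalized \<nu> summable_on UNIV" "normalized \<mu> summable_on UNIV"
    using normalized_has_sum[OF \<nu>_pos \<nu>_summable] normalized_has_sum[OF \<mu>_pos \<mu>_summable]
    by (auto simp: summable_on_def)
  fix y
  have "act_meas (normalized \<nu>) P y = act_meas \<nu> P y * (1 / (\<Sum>\<^sub>\<infinity>x. \<nu> x))"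
    unfolding act_meas_def normalized_def infsum_cmult_left'[symmetric] by simp
  then show "act_meas (normalized \<nu>) P y
      \<le> C * (\<Sum>\<^sub>\<infinity>x. \<mu> x) / (\<Sum>\<^sub>\<infinity>x. \<nu> x) * normalized \<mu> y"
    using dominated[of y] pos by (simp add: normalized_def field_simps)
qed

locale nondecreasing_env =
  fixes K :: "nat \<Rightarrow> 'v kernel" and \<pi> :: "nat \<Rightarrow> 'v \<Rightarrow> real"
  assumes markov_K: "\<And>t. 1 \<le> t \<Longrightarrow> markov (K t)"
    and env: "finite_nondecreasing_env K \<pi>"
    and \<pi>_0: "\<pi> 0 = \<pi> 1"
begin

lemma \<pi>_pos: "0 < \<pi> t x"
  using env \<pi>_0 by (cases t) (auto simp: finite_nondecreasing_env_def)

lemma \<pi>_summable: "\<pi> t summable_on UNIV"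
  using env \<pi>_0 by (cases t) (auto simp: finite_nondecreasing_env_def)

lemma \<pi>_Suc: "\<pi> t x \<le> \<pi> (Suc t) x"
  using env \<pi>_0 by (cases t) (auto simp: finite_nondecreasing_env_def)

lemma \<pi>_invariant: "act_meas (\<pi> (Suc t)) (K (Suc t)) = \<pi> (Suc t)"
  using env by (auto simp: finite_nondecreasing_env_def)

lemma dominated_kernel_step: "dominated_kernel (K (Suc s)) (\<pi> s) (\<pi> (Suc s)) 1"
proof
  show K: "markov (K (Suc s))" by (rule markov_K) simp
  interpret dominated_kernel "K (Suc s)" "\<pi> (Suc s)" "\<pi> (Suc s)" 1
    by standard (auto simp: K \<pi>_pos \<pi>_summable \<pi>_invariant)
  fix y
  have le: "\<pi> s x * K (Suc s) x y \<le> \<pi> (Suc s) x * K (Suc s) x y" for x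
    by (intro mult_right_mono \<pi>_Suc P_nonneg)
  have sum: "(\<lambda>x. \<pi> (Suc s) x * K (Suc s) x y) summable_on UNIV"
    using act_meas_has_sum by (auto simp: summable_on_def)
  have "act_meas (\<pi> s) (K (Suc s)) y \<le> act_meas (\<pi> (Suc s)) (K (Suc s)) y"
    unfolding act_meas_def
  proof (rule infsum_mono[OF _ sum le])
    show "(\<lambda>x. \<pi> s x * K (Suc s) x y) summable_on UNIV"
      by (rule summable_on_real_bound[OF sum])
        (use le \<pi>_pos[THEN less_imp_le] P_nonneg in \<open>auto simp: abs_mult\<close>)
  qed
  then show "act_meas (\<pi> s) (K (Suc s)) y \<le> 1 * \<pi> (Suc s) y"
    by (simp add: \<pi>_invariant)
qed (auto simp: \<pi>_pos \<pi>_summable)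

lemma dominated_kernel_between:
  assumes "s \<le> t"
  shows "dominated_kernel (kernel_between K s t) (\<pi> s) (\<pi> t) 1"
  using assms
proof (induction s rule: inc_induct)
  case base
  show ?case
    by standard
      (auto simp: kernel_between_refl markov_kernel_id \<pi>_pos \<pi>_summable act_meas_kernel_id)
next
  case (step s)
  then show ?case
    using dominated_kernel_mult[OF dominated_kernel_step step.IH]
    by (simp add: kernel_between_step)
qed

lemma K_op_semigroup:
  assumes "s \<le> r" "r \<le> t" and f: "(\<lambda>y. f y * \<pi> t y) summable_on UNIV"
  shows "K_op K s r (K_op K r t f) = K_op K s t f"
  using assms(1)
proof (induction s rule: inc_induct)
  case base
  show ?case by (simp add: K_op_def kernel_between_refl act_fun_kernel_id)
next
  case (step s)
  have "(\<lambda>y. K_op K r t f y * \<pi> r y) summable_on UNIV"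
    unfolding K_op_def
    by (rule dominated_kernel.act_fun_integrable[OF dominated_kernel_between[OF assms(2)] f])
  then have "K_op K s r (K_op K r t f) = act_fun (K (Suc s)) (K_op K (Suc s) r (K_op K r t f))"
    using step.hyps act_fun_kernel_mult[OF dominated_kernel_step dominated_kernel_between]
    by (simp add: K_op_def kernel_between_step)
  also have "\<dots> = act_fun (K (Suc s)) (K_op K (Suc s) t f)"
    by (simp only: step.IH)
  also have "\<dots> = K_op K s t f"
    using step.hyps assms(2) f act_fun_kernel_mult[OF dominated_kernel_step dominated_kernel_between]
    by (simp add: K_op_def kernel_between_step)
  finally show ?case .
qed

lemma normalized_dominated_kernel:
  assumes "s \<le> t"
  obtains C where
    "dominated_kernel (kernel_between K s t) (normalized (\<pi> s)) (normalized (\<pi> t)) C"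
  using dominated_kernel_normalized[OF dominated_kernel_between[OF assms]] by blast

lemma normalized_pos: "0 < normalized (\<pi> t) x"
  using \<pi>_pos infsum_positive[OF \<pi>_pos \<pi>_summable] by (simp add: normalized_def)

lemma normalized_\<pi>_has_sum: "(normalized (\<pi> t) has_sum 1) UNIV"
  by (rule normalized_has_sum[OF \<pi>_pos \<pi>_summable])

lemma normalized_integrable_iff:
  "(\<lambda>y. f y * normalized (\<pi> t) y) summable_on UNIV \<longleftrightarrow> (\<lambda>y. f y * \<pi> t y) summable_on UNIV"
  using summable_on_cmult_left'[of "1 / (\<Sum>\<^sub>\<infinity>y. \<pi> t y)" "\<lambda>y. f y * \<pi> t y" UNIV]
    infsum_positive[OF \<pi>_pos \<pi>_summable, of t]
  by (simp add: normalized_def)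

lemma K_op_is_dual:
  assumes "s \<le> t"
  shows "is_dual (normalized (\<pi> t)) (normalized (\<pi> s)) (K_op K s t)
    (\<lambda>g y. act_meas (\<lambda>x. g x * normalized (\<pi> s) x) (kernel_between K s t) y / normalized (\<pi> t) y)"
proof -
  obtain C where C: "dominated_kernel (kernel_between K s t)
      (normalized (\<pi> s)) (normalized (\<pi> t)) C"
    using normalized_dominated_kernel[OF assms] .
  show ?thesis
    using dominated_kernel.is_dual_adjoint[OF C] unfolding K_op_def
    by (simp add: dominated_kernel.adjoint_def[OF C, abs_def])
qed

lemma K_dual_eq:
  assumes "s \<le> t" "g \<in> ell2 (normalized (\<pi> s))"
  shows "K_dual K \<pi> s t g =
    (\<lambda>y. act_meas (\<lambda>x. g x * normalized (\<pi> s) x) (kernel_between K s t) y / normalized (\<pi> t) y)"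
  unfolding K_dual_def by (rule dual_eq[OF K_op_is_dual normalized_pos]) fact+

lemma one_ell2: "(\<lambda>_. 1) \<in> ell2 (normalized (\<pi> t))"
  using normalized_\<pi>_has_sum[of t] by (intro ell2_const) (auto simp: summable_on_def)

lemma O_op_is_dual:
  assumes "s \<le> t"
  shows "is_dual (normalized (\<pi> t)) (normalized (\<pi> s)) (O_op K \<pi> s t)
    (\<lambda>g x. K_dual K \<pi> s t g x - mean (normalized (\<pi> s)) g * K_dual K \<pi> s t (\<lambda>_. 1) x)"
proof -
  obtain C where C: "dominated_kernel (kernel_between K s t)
      (normalized (\<pi> s)) (normalized (\<pi> t)) C"
    using normalized_dominated_kernel[OF assms] .
  have adj: "K_dual K \<pi> s t g = dominated_kernel.adjoint (kernel_between K s t)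
      (normalized (\<pi> s)) (normalized (\<pi> t)) g" if "g \<in> ell2 (normalized (\<pi> s))" for g
    by (simp add: K_dual_eq[OF assms that] dominated_kernel.adjoint_def[OF C, abs_def])
  show ?thesis
    using dominated_kernel.is_dual_centred[OF C]
    by (simp add: is_dual_def Pi_iff O_op_def K_op_def adj one_ell2)
qed

lemma O_dual_eq:
  assumes "s \<le> t" "g \<in> ell2 (normalized (\<pi> s))"
  shows "O_dual K \<pi> s t g =
    (\<lambda>x. K_dual K \<pi> s t g x - mean (normalized (\<pi> s)) g * K_dual K \<pi> s t (\<lambda>_. 1) x)"
  unfolding O_dual_def by (rule dual_eq[OF O_op_is_dual normalized_pos]) fact+

lemma O_op_semigroup:
  assumes "s \<le> r" "r \<le> t" and f: "f \<in> ell2 (normalized (\<pi> t))"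
  shows "O_op K \<pi> s r (O_op K \<pi> r t f) = O_op K \<pi> s t f"
proof -
  have mass: "normalized (\<pi> s) summable_on UNIV" for s
    using normalized_\<pi>_has_sum summable_on_def by blast
  obtain C where "dominated_kernel (kernel_between K s r) (normalized (\<pi> s)) (normalized (\<pi> r)) C"
    using normalized_dominated_kernel[OF assms(1)] .
  then interpret sr: dominated_kernel "kernel_between K s r" "normalized (\<pi> s)"
    "normalized (\<pi> r)" C .
  obtain D where "dominated_kernel (kernel_between K r t) (normalized (\<pi> r)) (normalized (\<pi> t)) D"
    using normalized_dominated_kernel[OF assms(2)] .
  then interpret rt: dominated_kernel "kernel_between K r t" "normalized (\<pi> r)"
    "normalized (\<pi> t)" D .
  have int: "(\<lambda>y. f y * normalized (\<pi> t) y) summable_on UNIV"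
    by (rule ell2_integrable[OF rt.\<mu>_nonneg mass f])
  have int_r: "(\<lambda>y. K_op K r t f y * normalized (\<pi> r) y) summable_on UNIV"
    unfolding K_op_def by (rule rt.act_fun_integrable[OF int])
  define c where "c = mean (normalized (\<pi> r)) (K_op K r t f)"
  have "K_op K s r (O_op K \<pi> r t f) x = K_op K s r (K_op K r t f) x - c" for x
    using sr.act_fun_diff[OF int_r summable_on_cmult_right[OF mass], of c x]
    by (simp add: K_op_def O_op_def c_def sr.act_fun_const)
  then have shift: "K_op K s r (O_op K \<pi> r t f) = (\<lambda>x. K_op K s t f x - c)"
    using int K_op_semigroup[OF assms(1,2)] by (simp add: normalized_integrable_iff fun_eq_iff)
  have int_s: "(\<lambda>x. K_op K s t f x * normalized (\<pi> s) x) summable_on UNIV"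
    using sr.act_fun_integrable[OF int_r] int K_op_semigroup[OF assms(1,2)]
    by (simp add: normalized_integrable_iff K_op_def)
  have "mean (normalized (\<pi> s)) (\<lambda>x. K_op K s t f x - c) = mean (normalized (\<pi> s)) (K_op K s t f) - c"
    using infsum_diff_real[OF int_s summable_on_cmult_right[OF mass, of c]]
      infsumI[OF normalized_\<pi>_has_sum[of s]]
    by (simp add: mean_def left_diff_distrib infsum_cmult_right')
  then show ?thesis
    by (simp add: O_op_def[of K \<pi> s] shift)
qed

lemma law_density_0: "law_density K \<pi> z 0 = (\<lambda>x. 1 / normalized (\<pi> 0) z * kernel_id z x)"
  by (auto simp: law_density_def law_def kernel_between_refl act_meas_kernel_id kernel_id_def
      fun_eq_iff)

lemma law_density_0_mult: "law_density K \<pi> z 0 x * normalized (\<pi> 0) x = kernel_id z x"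
  using normalized_pos[of 0 x] by (simp add: law_density_0 kernel_id_def)

lemma O_dual_law_density:
  "O_dual K \<pi> 0 t (law_density K \<pi> z 0) =
    (\<lambda>x. law_density K \<pi> z t x - K_dual K \<pi> 0 t (\<lambda>_. 1) x)"
proof -
  have ell2: "law_density K \<pi> z 0 \<in> ell2 (normalized (\<pi> 0))"
    unfolding law_density_0 by (intro ell2_cmult ell2_kernel_id)
  have "mean (normalized (\<pi> 0)) (law_density K \<pi> z 0) = 1"
    using infsum_kronecker_left[of z "\<lambda>_. 1"] by (simp add: mean_def law_density_0_mult)
  moreover have "K_dual K \<pi> 0 t (law_density K \<pi> z 0) = law_density K \<pi> z t"
    unfolding K_dual_eq[OF le0 ell2] law_density_0_mult
    by (simp add: law_density_def law_def fun_eq_iff)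
  ultimately show ?thesis by (simp add: O_dual_eq ell2)
qed

end

theorem proposition3p8:
  fixes K :: "nat \<Rightarrow> ('v::countable) kernel" and \<pi> :: "nat \<Rightarrow> 'v \<Rightarrow> real"
  assumes "\<forall>t\<ge>1. markov (K t) \<and> irreducible_kernel (K t) \<and> aperiodic_kernel (K t)"
    and "finite_nondecreasing_env K \<pi>"
    and "\<pi> 0 = \<pi> 1"
  shows "(\<forall>s t. s \<le> t \<longrightarrow>
        is_dual (normalized (\<pi> t)) (normalized (\<pi> s)) (K_op K s t) (K_dual K \<pi> s t) \<and>
        is_dual (normalized (\<pi> t)) (normalized (\<pi> s)) (O_op K \<pi> s t) (O_dual K \<pi> s t))
    \<and> (\<forall>t\<ge>1. \<forall>s r. s \<le> r \<longrightarrow> r \<le> t \<longrightarrow>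
        (\<forall>f\<in>ell2 (normalized (\<pi> t)). O_op K \<pi> s r (O_op K \<pi> r t f) = O_op K \<pi> s t f))
    \<and> (\<forall>s t. s \<le> t \<longrightarrow> (\<forall>f\<in>ell2 (normalized (\<pi> s)).
        O_dual K \<pi> s t f =
          (\<lambda>x. K_dual K \<pi> s t f x - mean (normalized (\<pi> s)) f * K_dual K \<pi> s t (\<lambda>_. 1) x)))
    \<and> (\<forall>z. \<forall>t\<ge>1. O_dual K \<pi> 0 t (law_density K \<pi> z 0) =
        (\<lambda>x. law_density K \<pi> z t x - K_dual K \<pi> 0 t (\<lambda>_. 1) x))"
proof -
  interpret nondecreasing_env K \<pi>
    by standard (use assms in auto)
  have K_dual: "is_dual (normalized (\<pi> t)) (normalized (\<pi> s)) (K_op K s t) (K_dual K \<pi> s t)"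
    if "s \<le> t" for s t
    unfolding K_dual_def by (rule is_dual_dual[OF K_op_is_dual[OF that] normalized_pos])
  have O_dual: "is_dual (normalized (\<pi> t)) (normalized (\<pi> s)) (O_op K \<pi> s t) (O_dual K \<pi> s t)"
    if "s \<le> t" for s t
    unfolding O_dual_def by (rule is_dual_dual[OF O_op_is_dual[OF that] normalized_pos])
  show ?thesis
    by (intro conjI allI impI ballI;
        rule K_dual O_dual O_op_semigroup O_dual_eq O_dual_law_density; assumption)
qed

end
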